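(* Let $F$ be a field of characteristic $0$, and let $R$ be a nonzero monomial Rota--Baxter operator of weight $1$ on $F[x,y]$ such that $R(x)\in F$, $R(y)\in F$ and $\mathrm{Im}\,R\subseteq F$. Then $R=-T$, where $T$ is an operator of the form $$T(x^ny^m)=\begin{cases} a^n b^m, & n+m>0,\\ 1, & n=m=0,\end{cases}$$ for some $a,b\in F$.
   Context: $\mathbb{N}=\{0,1,2,\ldots\}$, $n,m$ range over $\mathbb{N}$, and $\mu^0=1$ for every $\mu\in F$ (in particular $0^0=1$). A linear operator $R$ on an algebra $A$ over $F$ is a Rota--Baxter operator of weight $\lambda\in F$ if $R(a)R(b)=R\big(R(a)b+aR(b)+\lambda ab\big)$ for all $a,b\in A$. A linear operator $L$ on $F[x,y]$ is called monomial if for all $k,l\in\mathbb{N}$ we have $L(x^ky^l)=\varepsilon_{kl}x^{a_{kl}}y^{b_{kl}}$ with $\varepsilon_{kl}\in F$, $a_{kl},b_{kl}\in\mathbb{N}$. Here $F$ is identified with the constant polynomials. *)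

theory Defs
  imports Complex_Main "HOL-Computational_Algebra.Polynomial"
begin

(* F[x,y] is rendered as F[x][y], i.e. the type 'a poly poly: the inner
   variable is x, the outer one is y. *)

definition X :: "'a::comm_ring_1 poly poly" where
  "X = [:[:0, 1:]:]"

definition Y :: "'a::comm_ring_1 poly poly" where
  "Y = [:0, 1:]"

definition const2 :: "'a::comm_ring_1 \<Rightarrow> 'a poly poly" where
  "const2 c = [:[:c:]:]"

definition scale2 :: "'a::comm_ring_1 \<Rightarrow> 'a poly poly \<Rightarrow> 'a poly poly" where
  "scale2 c p = smult [:c:] p"

lemma X_power_mult_Y_power: "X ^ k * Y ^ l = monom (monom 1 k) l"
proof -
  have "X ^ k = ([:monom 1 k:] :: 'a poly poly)"
    by (induction k) (simp_all add: X_def monom_0 monom_Suc flip: one_pCons)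
  moreover have "Y ^ l = (monom 1 l :: 'a poly poly)"
    by (induction l) (simp_all add: Y_def monom_0 monom_Suc flip: one_pCons)
  ultimately show ?thesis
    by (simp add: smult_monom)
qed

lemma const2_mult: "const2 c * p = scale2 c p"
  by (simp add: const2_def scale2_def)

lemma scale2_mult_left: "scale2 c p * q = scale2 c (p * q)"
  by (simp add: scale2_def)

lemma scale2_mult_right: "p * scale2 c q = scale2 c (p * q)"
  by (simp add: scale2_def)

lemma vector_space_scale2: "vector_space (scale2 :: 'a::field \<Rightarrow> _)"
proof
  fix a b :: 'a and p q :: "'a poly poly"
  have "[:a + b:] = [:a:] + [:b:]" by simp
  then show "scale2 (a + b) p = scale2 a p + scale2 b p"
    unfolding scale2_def by (simp only: smult_add_left)
  show "scale2 a (p + q) = scale2 a p + scale2 a q"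
    by (simp add: scale2_def smult_add_right)
  show "scale2 a (scale2 b p) = scale2 (a * b) p"
    by (simp add: scale2_def mult.commute)
  show "scale2 1 p = p"
    by (simp add: scale2_def flip: one_pCons)
qed

(* The algebra A is given by a ring type together with its scalar multiplication. *)
definition rota_baxter ::
    "('f::field \<Rightarrow> 'a::ring \<Rightarrow> 'a) \<Rightarrow> 'f \<Rightarrow> ('a \<Rightarrow> 'a) \<Rightarrow> bool" where
  "rota_baxter scale w R \<longleftrightarrow>
     Vector_Spaces.linear scale scale R \<and>
     (\<forall>a b. R a * R b = R (R a * b + a * R b + scale w (a * b)))"

definition monomial_operator :: "('a::field poly poly \<Rightarrow> 'a poly poly) \<Rightarrow> bool" where
  "monomial_operator L \<longleftrightarrow>
     Vector_Spaces.linear scale2 scale2 L \<and>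
     (\<exists>(\<epsilon> :: nat \<Rightarrow> nat \<Rightarrow> 'a) (a :: nat \<Rightarrow> nat \<Rightarrow> nat) (b :: nat \<Rightarrow> nat \<Rightarrow> nat).
        \<forall>k l. L (X ^ k * Y ^ l) = scale2 (\<epsilon> k l) (X ^ a k l * Y ^ b k l))"

end

theory Submission
  imports Defs
begin

text \<open>
  An operator with scalar values can be pulled out of itself:
  \<open>R (R p * q) = R p * R q\<close> and \<open>R (p * R q) = R p * R q\<close>, by linearity. In the Rota--Baxter
  identity of weight \<open>1\<close> two of the three terms on the right thus equal the left-hand side, which
  leaves \<open>R (p * q) = - R p * R q\<close>. Hence \<open>T = - R\<close> is multiplicative
  (\<open>rota_baxter_scalar_valued\<close>). Being nonzero with values in an integral domain, \<open>T\<close> maps \<open>1\<close>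
  to \<open>1\<close>, so it is a homomorphism of algebras onto the scalars, that is, evaluation at the point
  \<open>(a, b)\<close> with \<open>a = T X\<close> and \<open>b = T Y\<close>.
\<close>

text \<open>
  The weight multiplies only the term \<open>R (p * q)\<close>, so the cancellation works for every weight.
\<close>
lemma rota_baxter_scalar_valued:
  fixes R :: "'a::field poly poly \<Rightarrow> 'a poly poly"
  assumes "rota_baxter scale2 w R" and "range R \<subseteq> range const2"
  shows "scale2 w (R (p * q)) = - (R p * R q)"
proof -
  interpret R: Vector_Spaces.linear scale2 scale2 R
    using assms(1) by (simp add: rota_baxter_def)
  have pull_left: "R (R u * v) = R u * R v" for u v
  proof -
    obtain c where "R u = const2 c"
      using assms(2) by auto
    then show ?thesis
      by (simp add: const2_mult R.scale)
  qed
  have pull_right: "R (u * R v) = R u * R v" for u v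
    using pull_left[of v u] by (simp add: mult.commute)
  have "R p * R q = R (R p * q + p * R q + scale2 w (p * q))"
    using assms(1) by (simp add: rota_baxter_def)
  also have "\<dots> = R p * R q + R p * R q + scale2 w (R (p * q))"
    by (simp add: R.add R.scale pull_left pull_right)
  finally show ?thesis
    by (simp add: algebra_simps eq_neg_iff_add_eq_0)
qed

lemma multiplicative_one:
  fixes T :: "'b::idom \<Rightarrow> 'c::idom"
  assumes mult: "\<And>p q. T (p * q) = T p * T q" and "T p \<noteq> 0"
  shows "T 1 = 1"
proof -
  have "T p * T 1 = T p * 1"
    using mult[of p 1] by simp
  with \<open>T p \<noteq> 0\<close> show ?thesis
    by (metis mult_left_cancel)
qed

lemma multiplicative_power:
  fixes T :: "'b::monoid_mult \<Rightarrow> 'c::monoid_mult"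
  assumes "\<And>p q. T (p * q) = T p * T q" and "T 1 = 1"
  shows "T (p ^ n) = T p ^ n"
  by (induction n) (simp_all add: assms)

lemma const2_1: "const2 1 = 1"
  by (simp add: const2_def flip: one_pCons)

lemma const2_times: "const2 (c * d) = const2 c * const2 d"
  by (simp add: const2_def)

lemma const2_power: "const2 (c ^ n) = const2 c ^ n"
  by (induction n) (simp_all add: const2_1 const2_times)

theorem lemma5p1:
  fixes R :: "'a::field_char_0 poly poly \<Rightarrow> 'a poly poly"
  assumes "R \<noteq> (\<lambda>_. 0)"
    and "monomial_operator R"
    and "rota_baxter scale2 1 R"
    and "R X \<in> range const2"
    and "R Y \<in> range const2"
    and "range R \<subseteq> range const2"
  shows "\<exists>(a :: 'a) (b :: 'a) T.
           Vector_Spaces.linear scale2 scale2 T \<and>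
           (\<forall>n m :: nat. T (X ^ n * Y ^ m) =
              (if n + m > 0 then const2 (a ^ n * b ^ m) else 1)) \<and>
           R = (\<lambda>p. - T p)"
proof -
  interpret V: vector_space "scale2 :: 'a \<Rightarrow> _"
    by (rule vector_space_scale2)
  interpret R: Vector_Spaces.linear scale2 scale2 R
    using assms(3) by (simp add: rota_baxter_def)
  define T where "T p = - R p" for p
  have T_linear: "Vector_Spaces.linear scale2 scale2 T"
    by unfold_locales (simp_all add: T_def R.add R.scale)
  have T_mult: "T (p * q) = T p * T q" for p q
    using rota_baxter_scalar_valued[OF assms(3,6), of p q] by (simp add: T_def)
  from assms(1) obtain p where "T p \<noteq> 0"
    by (auto simp: T_def fun_eq_iff)
  with T_mult have T_1: "T 1 = 1"
    by (rule multiplicative_one)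
  note T_power = multiplicative_power[of T, OF T_mult T_1]
  obtain c d where "R X = const2 c" "R Y = const2 d"
    using assms(4,5) by auto
  then have T_X: "T X = const2 (- c)" and T_Y: "T Y = const2 (- d)"
    by (simp_all add: T_def const2_def)
  have "T (X ^ n * Y ^ m) = (if n + m > 0 then const2 ((- c) ^ n * (- d) ^ m) else 1)" for n m
    by (simp add: T_mult T_power T_X T_Y const2_times const2_power const2_1)
  moreover have "R = (\<lambda>p. - T p)"
    by (simp add: T_def)
  ultimately show ?thesis
    using T_linear by blast
qed

end
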